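(* Let $E$ be a complex Banach space, let $U_E$ be its open unit ball, and let $w$ be a bounded weight on $U_E$. Then the following assertions are equivalent: (a) $E$ has the bounded approximation property. (b) $\overline{B^{\lambda}_{\mathcal{H}_w(U_E)\otimes E}}^{\tau_c}=B_{\mathcal{H}_w(U_E,E)}$ for some $\lambda$ with $1\le\lambda<\infty$. (c) $I_{U_E}\in\overline{B^{\lambda'}_{\mathcal{H}_w(U_E)\otimes E}}^{\tau_c}$ for some $\lambda'$ with $1\le\lambda'<\infty$, where $I_{U_E}:U_E\to E$ is the inclusion mapping.
   Context: All Banach spaces are complex. For an open subset $U$ of a Banach space $E$ and a Banach space $F$, $\mathcal{H}(U,F)$ is the space of holomorphic maps $U\to F$, and $\tau_c$ is the topology of uniform convergence on compact subsets of $U$; $\overline{A}^{\tau_c}$ denotes the closure of $A$ for $\tau_c$. A set $A\subset U$ is $U$-bounded if it is bounded and there is a neighborhood $V$ of $0$ with $A+V\subset U$. A weight $w$ on $U$ is a continuous strictly positive function on $U$ with $0<\inf_A w\le\sup_A w<\infty$ for every $U$-bounded set $A$. It is bounded if $\sup_U w<\infty$. $\mathcal{H}_w(U,F)=\{f\in\mathcal{H}(U,F):\|f\|_w=\sup_{x\in U}w(x)\|f(x)\|<\infty\}$, normed by $\|\cdot\|_w$; $\mathcal{H}_w(U)=\mathcal{H}_w(U,\mathbb{C})$. $\mathcal{H}_w(U)\otimes F$ denotes the subspace of those $f\in\mathcal{H}_w(U,F)$ that have finite dimensional range, with the norm $\|\cdot\|_w$. For a normed space $X$, $B_X^{\lambda}=\{x\in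 X:\|x\|\le\lambda\}$ and $B_X=B_X^1$. $E$ has the $\lambda$-bounded approximation property ($1\le\lambda<\infty$) if for every compact $K\subset E$ and $\epsilon>0$ there is a finite rank bounded linear operator $T:E\to E$ with $\|T\|\le\lambda$ and $\sup_{x\in K}\|T(x)-x\|<\epsilon$; $E$ has the bounded approximation property if it has the $\lambda$-bounded approximation property for some $\lambda$, $1\le\lambda<\infty$.
   Formalization: In (b) the equality is replaced by the inclusion of the unit ball of H_w(U_E,E) in the τ_c-closure of the λ-ball of H_w(U_E)⊗E; literal equality forces λ=1 (E≠0), so for w=1 it gives the metric approximation property, which (a) does not imply (Figiel–Johnson). *)

theory Defs
  imports "HOL-Analysis.Analysis"
begin

section \<open>Complex Banach spaces\<close>

text \<open>A complex normed space is a real normed space with a compatible complex scalar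
  multiplication, so that the real library (bounded operators, Frechet derivatives, operator
  norm) applies to it.\<close>

class complex_normed_space = real_normed_vector +
  fixes scaleC :: "complex \<Rightarrow> 'a \<Rightarrow> 'a"  (infixr "*\<^sub>C" 75)
  assumes scaleC_add_right: "a *\<^sub>C (x + y) = a *\<^sub>C x + a *\<^sub>C y"
    and scaleC_add_left: "(a + b) *\<^sub>C x = a *\<^sub>C x + b *\<^sub>C x"
    and scaleC_scaleC: "a *\<^sub>C b *\<^sub>C x = (a * b) *\<^sub>C x"
    and scaleC_of_real: "complex_of_real r *\<^sub>C x = r *\<^sub>R x"
    and norm_scaleC: "norm (a *\<^sub>C x) = cmod a * norm x"

class complex_banach_space = complex_normed_space + banach

instantiation complex :: complex_banach_space
begin

definition scaleC_complex :: "complex \<Rightarrow> complex \<Rightarrow> complex"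
  where "scaleC_complex = (*)"

instance
  by standard (simp_all add: scaleC_complex_def algebra_simps norm_mult scaleR_conv_of_real)

end

lemma vector_space_scaleC: "vector_space (scaleC :: complex \<Rightarrow> 'a::complex_normed_space \<Rightarrow> 'a)"
proof
  show "1 *\<^sub>C x = x" for x :: 'a
    using scaleC_of_real[of 1 x] by simp
qed (simp_all add: scaleC_add_right scaleC_add_left scaleC_scaleC)

definition bounded_complex_linear ::
    "('a::complex_normed_space \<Rightarrow> 'b::complex_normed_space) \<Rightarrow> bool"
  where "bounded_complex_linear T \<longleftrightarrow> bounded_linear T \<and> (\<forall>c x. T (c *\<^sub>C x) = c *\<^sub>C T x)"

definition finite_dimensional :: "'a::complex_normed_space set \<Rightarrow> bool"
  where "finite_dimensional S \<longleftrightarrow> (\<exists>B. finite B \<and> S \<subseteq> module.span scaleC B)"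


section \<open>Approximation properties\<close>

text \<open>The operator norm \<open>onorm\<close> of a complex linear operator is the one of the
  underlying real operator; both are the supremum of \<open>norm (T x) / norm x\<close>.\<close>

definition lambda_bounded_approximation_property ::
    "'a::complex_banach_space itself \<Rightarrow> real \<Rightarrow> bool"
  where "lambda_bounded_approximation_property _ l \<longleftrightarrow>
    (\<forall>K :: 'a set. \<forall>e>0. compact K \<longrightarrow>
      (\<exists>T :: 'a \<Rightarrow> 'a. bounded_complex_linear T \<and> finite_dimensional (range T) \<and>
         onorm T \<le> l \<and> (\<forall>x\<in>K. norm (T x - x) < e)))"

definition bounded_approximation_property :: "'a::complex_banach_space itself \<Rightarrow> bool"
  where "bounded_approximation_property E \<longleftrightarrow>
    (\<exists>l\<ge>1. lambda_bounded_approximation_property E l)"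


section \<open>Holomorphic maps and the topology of compact convergence\<close>

text \<open>Maps on \<open>U\<close> are represented by total functions whose values outside \<open>U\<close> are
  irrelevant: every set and topology below depends only on the restrictions to \<open>U\<close>.
  Holomorphic means complex Frechet differentiable at each point of the open set \<open>U\<close>.\<close>

definition holomorphic_maps ::
    "'a::complex_banach_space set \<Rightarrow> ('a \<Rightarrow> 'b::complex_banach_space) set"
  where "holomorphic_maps U =
    {f. \<forall>x\<in>U. \<exists>D. bounded_complex_linear D \<and> (f has_derivative D) (at x)}"

definition tau_c_nbhd ::
    "'a::complex_banach_space set \<Rightarrow> ('a \<Rightarrow> 'b::complex_banach_space) \<Rightarrow> 'a set \<Rightarrow> real
      \<Rightarrow> ('a \<Rightarrow> 'b) set"
  where "tau_c_nbhd U f K e = {g \<in> holomorphic_maps U. \<forall>x\<in>K. norm (g x - f x) < e}"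

definition tau_c_open ::
    "'a::complex_banach_space set \<Rightarrow> ('a \<Rightarrow> 'b::complex_banach_space) set \<Rightarrow> bool"
  where "tau_c_open U S \<longleftrightarrow> S \<subseteq> holomorphic_maps U \<and>
    (\<forall>f\<in>S. \<exists>K e. compact K \<and> K \<subseteq> U \<and> 0 < e \<and> tau_c_nbhd U f K e \<subseteq> S)"

definition tau_c ::
    "'a::complex_banach_space set \<Rightarrow> ('a \<Rightarrow> 'b::complex_banach_space) topology"
  where "tau_c U = topology (tau_c_open U)"

lemma istopology_tau_c_open:
  "istopology (tau_c_open U :: ('a::complex_banach_space \<Rightarrow> 'b::complex_banach_space) set \<Rightarrow> bool)"
  unfolding istopology_def
proof (intro conjI allI impI)
  fix S T :: "('a \<Rightarrow> 'b) set"
  assume S: "tau_c_open U S" and T: "tau_c_open U T"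
  show "tau_c_open U (S \<inter> T)"
    unfolding tau_c_open_def
  proof (intro conjI ballI)
    show "S \<inter> T \<subseteq> holomorphic_maps U"
      using S by (auto simp: tau_c_open_def)
    fix f assume "f \<in> S \<inter> T"
    then obtain K e L d where K: "compact K" "K \<subseteq> U" "0 < e" "tau_c_nbhd U f K e \<subseteq> S"
      and L: "compact L" "L \<subseteq> U" "0 < d" "tau_c_nbhd U f L d \<subseteq> T"
      using S T unfolding tau_c_open_def by (meson IntD1 IntD2)
    have "tau_c_nbhd U f (K \<union> L) (min e d) \<subseteq> tau_c_nbhd U f K e \<inter> tau_c_nbhd U f L d"
      by (auto simp: tau_c_nbhd_def)
    with K L show "\<exists>K e. compact K \<and> K \<subseteq> U \<and> 0 < e \<and> tau_c_nbhd U f K e \<subseteq> S \<inter> T"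
      by (intro exI[of _ "K \<union> L"] exI[of _ "min e d"]) (auto simp: compact_Un)
  qed
next
  fix \<K> :: "('a \<Rightarrow> 'b) set set"
  assume *: "\<forall>S\<in>\<K>. tau_c_open U S"
  show "tau_c_open U (\<Union>\<K>)"
    unfolding tau_c_open_def
  proof (intro conjI ballI)
    show "\<Union>\<K> \<subseteq> holomorphic_maps U"
      using * by (auto simp: tau_c_open_def)
    fix f assume "f \<in> \<Union>\<K>"
    then obtain S where "S \<in> \<K>" "f \<in> S" by blast
    then show "\<exists>K e. compact K \<and> K \<subseteq> U \<and> 0 < e \<and> tau_c_nbhd U f K e \<subseteq> \<Union>\<K>"
      using * unfolding tau_c_open_def by (meson Union_upper order_trans)
  qed
qed

lemma openin_tau_c: "openin (tau_c U) S \<longleftrightarrow> tau_c_open U S"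
  by (simp add: tau_c_def istopology_tau_c_open topology_inverse')

section \<open>Weighted spaces\<close>

definition U_bounded :: "'a::complex_banach_space set \<Rightarrow> 'a set \<Rightarrow> bool"
  where "U_bounded U A \<longleftrightarrow> A \<subseteq> U \<and> bounded A \<and>
    (\<exists>V. open V \<and> 0 \<in> V \<and> (\<forall>a\<in>A. \<forall>v\<in>V. a + v \<in> U))"

text \<open>\<open>A \<noteq> {}\<close> is required only because the infimum of the empty set of reals is
  unspecified.\<close>

definition weight :: "'a::complex_banach_space set \<Rightarrow> ('a \<Rightarrow> real) \<Rightarrow> bool"
  where "weight U w \<longleftrightarrow> continuous_on U w \<and> (\<forall>x\<in>U. 0 < w x) \<and>
    (\<forall>A. U_bounded U A \<and> A \<noteq> {} \<longrightarrow> 0 < (INF x\<in>A. w x) \<and> bdd_above (w ` A))"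

definition bounded_weight :: "'a::complex_banach_space set \<Rightarrow> ('a \<Rightarrow> real) \<Rightarrow> bool"
  where "bounded_weight U w \<longleftrightarrow> weight U w \<and> bdd_above (w ` U)"

definition weighted_norm ::
    "'a::complex_banach_space set \<Rightarrow> ('a \<Rightarrow> real) \<Rightarrow> ('a \<Rightarrow> 'b::complex_banach_space) \<Rightarrow> real"
  where "weighted_norm U w f = (SUP x\<in>U. w x * norm (f x))"

definition weighted_space ::
    "'a::complex_banach_space set \<Rightarrow> ('a \<Rightarrow> real) \<Rightarrow> ('a \<Rightarrow> 'b::complex_banach_space) set"
  where "weighted_space U w =
    {f \<in> holomorphic_maps U. bdd_above ((\<lambda>x. w x * norm (f x)) ` U)}"

text \<open>The subspace usually denoted by the tensor product of the scalar-valued weighted space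
  with the range space.\<close>

definition weighted_tensor ::
    "'a::complex_banach_space set \<Rightarrow> ('a \<Rightarrow> real) \<Rightarrow> ('a \<Rightarrow> 'b::complex_banach_space) set"
  where "weighted_tensor U w = {f \<in> weighted_space U w. finite_dimensional (f ` U)}"

definition weighted_space_ball ::
    "'a::complex_banach_space set \<Rightarrow> ('a \<Rightarrow> real) \<Rightarrow> real
      \<Rightarrow> ('a \<Rightarrow> 'b::complex_banach_space) set"
  where "weighted_space_ball U w l = {f \<in> weighted_space U w. weighted_norm U w f \<le> l}"

definition weighted_tensor_ball ::
    "'a::complex_banach_space set \<Rightarrow> ('a \<Rightarrow> real) \<Rightarrow> real
      \<Rightarrow> ('a \<Rightarrow> 'b::complex_banach_space) set"
  where "weighted_tensor_ball U w l = {f \<in> weighted_tensor U w. weighted_norm U w f \<le> l}"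

end

theory Submission
  imports Defs "HOL-Complex_Analysis.Cauchy_Integral_Formula"
begin

text \<open>If \<open>T\<close> is a finite rank operator that is nearly the identity on \<open>f K\<close>, then \<open>T \<circ> f\<close>
  approximates \<open>f\<close> on \<open>K\<close> and its weighted norm grows by at most the factor \<open>\<parallel>T\<parallel>\<close>. Since the weight is
  bounded, a multiple of the inclusion lies in the unit ball of the weighted space. Conversely, if \<open>f\<close>
  has finite-dimensional range and is close to the inclusion on a compact set, its derivative at \<open>0\<close>
  is a finite rank operator. Cauchy's estimate on the ball of radius 1/2, where the weight is bounded
  below, bounds its norm independently of \<open>f\<close>; applied to \<open>f\<close> minus the inclusion on circles through
  points of a small multiple of \<open>K\<close>, it shows that the derivative is nearly the identity on \<open>K\<close>.\<close>

section \<open>Complex scalars and finite-dimensional spans\<close>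

interpretation C: vector_space "scaleC :: complex \<Rightarrow> 'a \<Rightarrow> 'a::complex_normed_space"
  by (rule vector_space_scaleC)

lemma bounded_bilinear_scaleC:
  "bounded_bilinear (scaleC :: complex \<Rightarrow> 'a \<Rightarrow> 'a::complex_normed_space)"
proof
  fix r :: real and a a' :: complex and b b' :: 'a
  show "(a + a') *\<^sub>C b = a *\<^sub>C b + a' *\<^sub>C b" "a *\<^sub>C (b + b') = a *\<^sub>C b + a *\<^sub>C b'"
    by (rule scaleC_add_left scaleC_add_right)+
  show "(r *\<^sub>R a) *\<^sub>C b = r *\<^sub>R (a *\<^sub>C b)"
    by (simp only: scaleR_conv_of_real scaleC_scaleC[symmetric] scaleC_of_real)
  show "a *\<^sub>C (r *\<^sub>R b) = r *\<^sub>R (a *\<^sub>C b)"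
    by (simp only: scaleC_of_real[of r, symmetric] scaleC_scaleC mult.commute)
  show "\<exists>K. \<forall>a b::'a. norm (a *\<^sub>C b) \<le> norm a * norm b * K"
    by (intro exI[of _ 1]) (simp add: norm_scaleC)
qed

lemma bounded_complex_linearD:
  assumes "bounded_complex_linear T"
  shows "bounded_linear T" "T (c *\<^sub>C x) = c *\<^sub>C T x"
  using assms by (auto simp: bounded_complex_linear_def)

text \<open>Dividing \<open>v + k *\<^sub>C b\<close> by \<open>k\<close> gives the difference of
  \<open>b\<close> and a vector of the span, whose norm is at least the distance. When
  \<open>b\<close> has positive distance from the span, this controls the coefficient
  \<open>k\<close>.\<close>

lemma infdist_span_bound:
  fixes b :: "'a::complex_normed_space"
  assumes "v \<in> C.span B"
  shows "cmod k * infdist b (C.span B) \<le> norm (v + k *\<^sub>C b)"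
proof (cases "k = 0")
  case False
  have "(- 1 / k) *\<^sub>C v \<in> C.span B"
    using assms by (rule C.span_scale)
  then have "infdist b (C.span B) \<le> dist b ((- 1 / k) *\<^sub>C v)"
    by (rule infdist_le)
  also have "\<dots> = norm ((1 / k) *\<^sub>C (v + k *\<^sub>C b))"
    using False by (simp add: dist_norm scaleC_add_right scaleC_scaleC C.scale_minus_left add.commute)
  also have "\<dots> = norm (v + k *\<^sub>C b) / cmod k"
    by (simp add: norm_scaleC norm_divide)
  finally show ?thesis
    using False by (simp add: field_simps)
qed simp

text \<open>Induction on generators. If \<open>b\<close> lies outside the closed span of
  \<open>B\<close>, its distance from that span is positive, so the coefficients of \<open>b\<close>
  along a convergent sequence are Cauchy. They converge, and so do the remainders in the span of
  \<open>B\<close>.\<close>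

lemma closed_span_finite:
  fixes B :: "'a::complex_banach_space set"
  assumes "finite B"
  shows "closed (C.span B)"
  using assms
proof induction
  case empty
  then show ?case by simp
next
  case (insert b B)
  show ?case
  proof (cases "b \<in> C.span B")
    case True
    then show ?thesis
      using insert.IH by (simp add: C.span_redundant)
  next
    case False
    define d where "d = infdist b (C.span B)"
    have "d > 0"
      unfolding d_def using False insert.IH C.span_zero[of B]
      by (intro infdist_pos_not_in_closed) auto
    show ?thesis
      unfolding closed_sequential_limits
    proof (intro allI impI, elim conjE)
      fix y l assume y: "\<forall>n. y n \<in> C.span (insert b B)" and lim: "y \<longlonglongrightarrow> l"
      obtain k where k: "\<And>n. y n - k n *\<^sub>C b \<in> C.span B"
        using y unfolding C.span_breakdown_eq by metis
      have bound: "cmod (k n - k m) * d \<le> norm (y n - y m)" for n m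
      proof -
        have "(y n - k n *\<^sub>C b) - (y m - k m *\<^sub>C b) \<in> C.span B"
          by (intro C.span_diff k)
        from infdist_span_bound[OF this, of "k n - k m" b] show ?thesis
          by (simp add: d_def C.scale_left_diff_distrib)
      qed
      have "Cauchy k"
      proof (rule metric_CauchyI)
        fix e :: real assume "e > 0"
        with \<open>d > 0\<close> have "e * d > 0" by simp
        then obtain M where M: "\<forall>m\<ge>M. \<forall>n\<ge>M. dist (y m) (y n) < e * d"
          using metric_CauchyD[OF LIMSEQ_imp_Cauchy[OF lim]] by blast
        have "dist (k m) (k n) < e" if "m \<ge> M" "n \<ge> M" for m n
        proof -
          have "cmod (k m - k n) * d < e * d"
            using bound[of m n] M that by (force simp: dist_norm)
          then show ?thesis
            using \<open>d > 0\<close> by (simp add: dist_norm)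
        qed
        then show "\<exists>M. \<forall>m\<ge>M. \<forall>n\<ge>M. dist (k m) (k n) < e" by blast
      qed
      then obtain k' where "k \<longlonglongrightarrow> k'"
        using Cauchy_convergent convergent_def by blast
      then have "(\<lambda>n. y n - k n *\<^sub>C b) \<longlonglongrightarrow> l - k' *\<^sub>C b"
        by (intro tendsto_diff lim bounded_bilinear.tendsto[OF bounded_bilinear_scaleC] tendsto_const)
      then have "l - k' *\<^sub>C b \<in> C.span B"
        by (rule closed_sequentially[OF insert.IH k])
      then show "l \<in> C.span (insert b B)"
        unfolding C.span_breakdown_eq by blast
    qed
  qed
qed

text \<open>By independence and closedness, \<open>b\<close> has positive distance \<open>d\<close>
  from the span of the other basis vectors. The distance bound then gives the constant
  \<open>1 / d\<close> for the coordinate at \<open>b\<close>.\<close>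

lemma representation_bounded:
  fixes B :: "'a::complex_banach_space set"
  assumes fin: "finite B" and indep: "\<not> C.dependent B" and b: "b \<in> B"
  obtains M where "M > 0" "\<And>y. y \<in> C.span B \<Longrightarrow> cmod (C.representation B y b) \<le> M * norm y"
proof
  define d where "d = infdist b (C.span (B - {b}))"
  have "b \<notin> C.span (B - {b})"
    using indep b unfolding C.dependent_def by blast
  then have "d > 0"
    unfolding d_def using closed_span_finite[of "B - {b}"] fin C.span_zero[of "B - {b}"]
    by (intro infdist_pos_not_in_closed) auto
  then show "1 / d > 0" by simp
  fix y assume y: "y \<in> C.span B"
  define v where "v = (\<Sum>a\<in>B - {b}. C.representation B y a *\<^sub>C a)"
  have "v \<in> C.span (B - {b})"
    unfolding v_def by (intro C.span_sum C.span_scale C.span_base)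
  moreover have "y = v + C.representation B y b *\<^sub>C b"
    using C.sum_representation_eq[OF indep y fin order.refl] fin b
    by (simp add: v_def sum.remove add.commute)
  ultimately have "cmod (C.representation B y b) * d \<le> norm y"
    unfolding d_def using infdist_span_bound by metis
  then show "cmod (C.representation B y b) \<le> 1 / d * norm y"
    using \<open>d > 0\<close> by (simp add: field_simps)
qed

section \<open>Derivatives of maps with values in a finite-dimensional span\<close>

text \<open>Difference quotients stay in the span, and the span is closed, so their limit stays
  there too. This is what makes the derivative at \<open>0\<close> a finite rank operator.\<close>

lemma derivative_in_span:
  fixes f :: "'b::real_normed_vector \<Rightarrow> 'a::complex_banach_space"
  assumes f: "(f has_derivative D) (at x)" and "finite B"
    and S: "open S" "x \<in> S" "f ` S \<subseteq> C.span B"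
  shows "D h \<in> C.span B"
proof -
  interpret D: bounded_linear D using f by (rule has_derivative_bounded_linear)
  \<comment> \<open>Only real increments along the direction \<open>h\<close> are considered; their
    quotients already converge to \<open>D h\<close>.\<close>
  have "((\<lambda>t::real. f (x + t *\<^sub>R h)) has_derivative (\<lambda>t. D (t *\<^sub>R h))) (at 0)"
    by (rule has_derivative_compose[where f = "\<lambda>t. x + t *\<^sub>R h" and g = f])
      (use f in \<open>auto intro!: derivative_eq_intros\<close>)
  then have "((\<lambda>t::real. norm (f (x + t *\<^sub>R h) - f x - D (t *\<^sub>R h)) / norm t) \<longlongrightarrow> 0) (at 0)"
    by (simp add: has_derivative_iff_norm)
  then have "((\<lambda>t::real. norm ((f (x + t *\<^sub>R h) - f x) /\<^sub>R t - D h)) \<longlongrightarrow> 0) (at 0)"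
  proof (rule Lim_transform_eventually)
    have "norm (f (x + t *\<^sub>R h) - f x - D (t *\<^sub>R h)) / norm t
        = norm ((f (x + t *\<^sub>R h) - f x) /\<^sub>R t - D h)" if "t \<noteq> 0" for t :: real
    proof -
      have "(f (x + t *\<^sub>R h) - f x) /\<^sub>R t - D h = (f (x + t *\<^sub>R h) - f x - D (t *\<^sub>R h)) /\<^sub>R t"
        using that by (simp add: D.scaleR scaleR_diff_right)
      then show ?thesis by (simp add: divide_inverse_commute)
    qed
    then show "\<forall>\<^sub>F t in at (0::real). norm (f (x + t *\<^sub>R h) - f x - D (t *\<^sub>R h)) / norm t
        = norm ((f (x + t *\<^sub>R h) - f x) /\<^sub>R t - D h)"
      by (auto simp: eventually_at_filter)
  qed
  then have lim: "((\<lambda>t::real. (f (x + t *\<^sub>R h) - f x) /\<^sub>R t) \<longlongrightarrow> D h) (at 0)"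
    using Lim_null tendsto_norm_zero_iff by blast
  have "((\<lambda>t::real. x + t *\<^sub>R h) \<longlongrightarrow> x + 0 *\<^sub>R h) (at 0)"
    by (intro tendsto_intros)
  then have "\<forall>\<^sub>F t in at (0::real). x + t *\<^sub>R h \<in> S"
    using S topological_tendstoD by fastforce
  then have "\<forall>\<^sub>F t in at (0::real). (f (x + t *\<^sub>R h) - f x) /\<^sub>R t \<in> C.span B"
    by eventually_elim (use S in \<open>auto simp flip: scaleC_of_real intro!: C.span_scale C.span_diff\<close>)
  then show ?thesis
    by (rule Lim_in_closed_set[OF closed_span_finite[OF \<open>finite B\<close>] _ _ lim]) simp
qed

text \<open>A coordinate is linear and bounded on the span only, since
  \<open>C.representation\<close> takes the default value 0 elsewhere. Instead of a chain rule, the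
  remainder of the coordinate is therefore compared directly with \<open>M\<close> times the
  remainder of \<open>g\<close>, all vectors involved lying in the span.\<close>

lemma has_field_derivative_representation:
  fixes g :: "complex \<Rightarrow> 'a::complex_banach_space"
  assumes fin: "finite B" and indep: "\<not> C.dependent B" and b: "b \<in> B"
    and S: "open S" "z \<in> S" "g ` S \<subseteq> C.span B"
    and g: "(g has_derivative (\<lambda>h. h *\<^sub>C d)) (at z)"
  shows "((\<lambda>u. C.representation B (g u) b) has_field_derivative C.representation B d b) (at z)"
proof -
  obtain M where M: "M > 0"
    "\<And>y. y \<in> C.span B \<Longrightarrow> cmod (C.representation B y b) \<le> M * norm y"
    using representation_bounded[OF fin indep b] by metis
  let ?c = "\<lambda>y. C.representation B y b"
  have d: "d \<in> C.span B"
    using derivative_in_span[OF g fin S, of 1] by simp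
  have "((\<lambda>u. norm (?c (g u) - ?c (g z) - ?c d * (u - z)) / norm (u - z)) \<longlongrightarrow> 0) (at z)"
  proof (rule Lim_null_comparison)
    have "((\<lambda>u. norm (g u - g z - (u - z) *\<^sub>C d) / norm (u - z)) \<longlongrightarrow> 0) (at z)"
      using g by (simp add: has_derivative_iff_norm)
    then show "((\<lambda>u. M * (norm (g u - g z - (u - z) *\<^sub>C d) / norm (u - z))) \<longlongrightarrow> 0) (at z)"
      by (rule tendsto_mult_right_zero)
    have "\<forall>\<^sub>F u in at z. u \<in> S"
      using S eventually_at_topological by blast
    then show "\<forall>\<^sub>F u in at z. norm (norm (?c (g u) - ?c (g z) - ?c d * (u - z)) / norm (u - z))
        \<le> M * (norm (g u - g z - (u - z) *\<^sub>C d) / norm (u - z))"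
    proof eventually_elim
      case (elim u)
      have in_span: "g u \<in> C.span B" "g z \<in> C.span B"
        using S elim by auto
      then have "?c (g u - g z - (u - z) *\<^sub>C d) = ?c (g u) - ?c (g z) - (u - z) * ?c d"
        using d indep
        by (simp add: C.representation_diff C.representation_scale C.span_diff C.span_scale)
      moreover have "g u - g z - (u - z) *\<^sub>C d \<in> C.span B"
        using in_span d by (intro C.span_diff C.span_scale)
      ultimately show ?case
        using M(2)[of "g u - g z - (u - z) *\<^sub>C d"]
        using divide_right_mono[OF _ norm_ge_zero[of "u - z"]]
        by (fastforce simp: mult.commute)
    qed
  qed
  then show ?thesis
    by (simp add: has_field_derivative_def has_derivative_iff_norm bounded_linear_mult_right)
qed

section \<open>Cauchy's formula and estimate on the unit circle\<close>

text \<open>Cauchy's formula for the first derivative integrates \<open>c u / u^2\<close>. On the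
  circle \<open>du = 2 * pi * \<i> * u dt\<close>, which cancels one factor \<open>u\<close> and the
  factor in front of the derivative. The radius 2 leaves room around the closed unit disc.\<close>

lemma cauchy_unit_circle_scalar:
  assumes "c holomorphic_on ball 0 2"
  shows "((\<lambda>t. inverse (circlepath 0 1 t) * c (circlepath 0 1 t)) has_integral deriv c 0) {0..1}"
proof -
  have "((\<lambda>u. c u / (u - 0) ^ Suc 1) has_contour_integral
      ((2 * pi * \<i>) / (fact 1) * (deriv ^^ 1) c 0)) (circlepath 0 1)"
    by (rule Cauchy_has_contour_integral_higher_derivative_circlepath)
      (use assms in \<open>auto intro: holomorphic_on_subset
        intro!: holomorphic_on_imp_continuous_on\<close>)
  then have "((\<lambda>t. c (circlepath 0 1 t) / (circlepath 0 1 t)\<^sup>2 *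
      (2 * pi * \<i> * exp (2 * of_real pi * \<i> * t))) has_integral 2 * pi * \<i> * deriv c 0) {0..1}"
    unfolding has_contour_integral_def
    by (rule has_integral_eq_rhs[OF has_integral_eq, rotated])
      (simp_all add: vector_derivative_circlepath01 power2_eq_square)
  from has_integral_mult_right[OF this, of "1 / (2 * pi * \<i>)"]
  show ?thesis
    by (simp add: circlepath power2_eq_square field_simps)
qed

text \<open>Finite-dimensionality of the range lets the scalar Cauchy formula be applied coordinatewise;
  no Hahn-Banach theorem is needed.\<close>

lemma cauchy_unit_circle:
  fixes g :: "complex \<Rightarrow> 'a::complex_banach_space"
  assumes fin: "finite_dimensional (g ` ball 0 2)"
    and g: "\<And>z. z \<in> ball 0 2 \<Longrightarrow> (g has_derivative (\<lambda>h. h *\<^sub>C d z)) (at z)"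
  shows "((\<lambda>t. inverse (circlepath 0 1 t) *\<^sub>C g (circlepath 0 1 t)) has_integral d 0) {0..1}"
proof -
  obtain B0 where "finite B0" "g ` ball 0 2 \<subseteq> C.span B0"
    using fin unfolding finite_dimensional_def by blast
  \<comment> \<open>Finite-dimensionality supplies only generators; coordinates require an
    independent set with the same span.\<close>
  moreover obtain B where "B \<subseteq> B0" "\<not> C.dependent B" "C.span B0 \<subseteq> C.span B"
    using C.maximal_independent_subset[of B0] C.span_minimal C.subspace_span by metis
  ultimately have B: "finite B" "\<not> C.dependent B" and span: "g ` ball 0 2 \<subseteq> C.span B"
    using finite_subset by blast+
  let ?c = "\<lambda>b y. C.representation B y b"
  have expand: "y = (\<Sum>b\<in>B. ?c b y *\<^sub>C b)" if "y \<in> C.span B" for y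
    using C.sum_representation_eq[OF B(2) that B(1)] by simp
  have der: "((\<lambda>u. ?c b (g u)) has_field_derivative ?c b (d z)) (at z)"
    if "b \<in> B" "z \<in> ball 0 2" for b z
    by (rule has_field_derivative_representation[OF B that(1) open_ball that(2) span g[OF that(2)]])
  have "((\<lambda>t. \<Sum>b\<in>B. (inverse (circlepath 0 1 t) * ?c b (g (circlepath 0 1 t))) *\<^sub>C b)
      has_integral (\<Sum>b\<in>B. ?c b (d 0) *\<^sub>C b)) {0..1}"
  proof (intro has_integral_sum B(1))
    fix b assume b: "b \<in> B"
    have "(\<lambda>u. ?c b (g u)) holomorphic_on ball 0 2"
      using der[OF b] unfolding holomorphic_on_open[OF open_ball] by blast
    from cauchy_unit_circle_scalar[OF this]
    have "((\<lambda>t. inverse (circlepath 0 1 t) * ?c b (g (circlepath 0 1 t)))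
        has_integral ?c b (d 0)) {0..1}"
      using DERIV_imp_deriv[OF der[OF b, of 0]] by simp
    from has_integral_linear[OF this bounded_bilinear.bounded_linear_left[OF bounded_bilinear_scaleC]]
    show "((\<lambda>t. (inverse (circlepath 0 1 t) * ?c b (g (circlepath 0 1 t))) *\<^sub>C b)
        has_integral ?c b (d 0) *\<^sub>C b) {0..1}"
      by (simp add: o_def)
  qed
  moreover have "(\<Sum>b\<in>B. (inverse (circlepath 0 1 t) * ?c b (g (circlepath 0 1 t))) *\<^sub>C b)
      = inverse (circlepath 0 1 t) *\<^sub>C g (circlepath 0 1 t)" for t
  proof -
    have "g (circlepath 0 1 t) \<in> C.span B"
      using span by (auto simp: circlepath norm_mult)
    then show ?thesis
      by (subst (2) expand) (simp_all add: C.scale_sum_right scaleC_scaleC)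
  qed
  moreover have "d 0 \<in> C.span B"
    using derivative_in_span[OF g[of 0] B(1) open_ball _ span, of 1] by simp
  ultimately show ?thesis
    using expand[of "d 0"] by simp
qed

text \<open>The integrand has norm at most \<open>M\<close> on an interval of length 1, so no
  further constant appears.\<close>

lemma cauchy_estimate_unit_circle:
  fixes g :: "complex \<Rightarrow> 'a::complex_banach_space"
  assumes "finite_dimensional (g ` ball 0 2)"
    and "\<And>z. z \<in> ball 0 2 \<Longrightarrow> (g has_derivative (\<lambda>h. h *\<^sub>C d z)) (at z)"
    and M: "0 \<le> M" "\<And>z. cmod z = 1 \<Longrightarrow> norm (g z) \<le> M"
  shows "norm (d 0) \<le> M"
proof -
  have "norm (circlepath 0 1 t) = 1" for t
    by (simp add: circlepath norm_mult)
  then have "norm (inverse (circlepath 0 1 t) *\<^sub>C g (circlepath 0 1 t)) \<le> M" for t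
    using M(2) by (simp add: norm_scaleC norm_inverse)
  then show ?thesis
    using has_integral_bound_real[OF M(1) finite.emptyI cauchy_unit_circle[OF assms(1,2)]] by simp
qed

section \<open>Holomorphic maps and closures for compact convergence\<close>

lemma finite_dimensional_subset:
  "finite_dimensional T \<Longrightarrow> S \<subseteq> T \<Longrightarrow> finite_dimensional S"
  unfolding finite_dimensional_def by blast

lemma holomorphic_maps_continuous_on:
  "f \<in> holomorphic_maps U \<Longrightarrow> S \<subseteq> U \<Longrightarrow> continuous_on S f"
  unfolding holomorphic_maps_def continuous_on_eq_continuous_within
  by (blast intro: continuous_at_imp_continuous_within has_derivative_continuous)

lemma holomorphic_maps_compose:
  assumes "bounded_complex_linear T" "f \<in> holomorphic_maps U"
  shows "(\<lambda>x. T (f x)) \<in> holomorphic_maps U"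
  unfolding holomorphic_maps_def
proof (intro CollectI ballI)
  fix x assume "x \<in> U"
  then obtain D where D: "bounded_complex_linear D" "(f has_derivative D) (at x)"
    using assms(2) unfolding holomorphic_maps_def by blast
  show "\<exists>D. bounded_complex_linear D \<and> ((\<lambda>x. T (f x)) has_derivative D) (at x)"
  proof (intro exI conjI)
    show "bounded_complex_linear (\<lambda>h. T (D h))"
      using assms(1) D(1) unfolding bounded_complex_linear_def
      by (auto intro: bounded_linear_compose)
    show "((\<lambda>x. T (f x)) has_derivative (\<lambda>h. T (D h))) (at x)"
      using bounded_linear.has_derivative[OF bounded_complex_linearD(1)[OF assms(1)] D(2)] .
  qed
qed

lemma bounded_complex_linear_scaleR:
  "bounded_complex_linear (\<lambda>x::'a::complex_normed_space. r *\<^sub>R x)"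
  unfolding bounded_complex_linear_def
  by (auto simp: bounded_linear_scaleR_right scaleC_scaleC mult.commute simp flip: scaleC_of_real)

lemma holomorphic_maps_scaleR:
  "f \<in> holomorphic_maps U \<Longrightarrow> (\<lambda>x. r *\<^sub>R f x) \<in> holomorphic_maps U"
  by (rule holomorphic_maps_compose[OF bounded_complex_linear_scaleR])

lemma ident_holomorphic: "(\<lambda>x. x) \<in> holomorphic_maps U"
  unfolding holomorphic_maps_def bounded_complex_linear_def
  by (auto intro!: exI[of _ "\<lambda>x. x"])

text \<open>On the compact set the deviation of \<open>g\<close> from \<open>f\<close> attains its
  maximum, which is therefore strictly below \<open>e\<close>. The gap serves as a radius around
  \<open>g\<close>.\<close>

lemma openin_tau_c_nbhd:
  assumes f: "f \<in> holomorphic_maps U" and K: "compact K" "K \<subseteq> U"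
  shows "openin (tau_c U) (tau_c_nbhd U f K e)"
  unfolding openin_tau_c tau_c_open_def
proof (intro conjI ballI)
  show "tau_c_nbhd U f K e \<subseteq> holomorphic_maps U"
    by (auto simp: tau_c_nbhd_def)
  fix g assume g: "g \<in> tau_c_nbhd U f K e"
  then have g': "g \<in> holomorphic_maps U" "\<And>x. x \<in> K \<Longrightarrow> norm (g x - f x) < e"
    by (auto simp: tau_c_nbhd_def)
  show "\<exists>L d. compact L \<and> L \<subseteq> U \<and> 0 < d \<and> tau_c_nbhd U g L d \<subseteq> tau_c_nbhd U f K e"
  proof (cases "K = {}")
    \<comment> \<open>No maximum exists over the empty set, but the neighbourhood is then the whole
      space.\<close>
    case True
    then show ?thesis
      by (intro exI[of _ "{}"] exI[of _ 1]) (auto simp: tau_c_nbhd_def)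
  next
    case False
    have "continuous_on K (\<lambda>x. norm (g x - f x))"
      using f g'(1) K by (intro continuous_intros) (auto intro: holomorphic_maps_continuous_on)
    then obtain a where a: "a \<in> K" "\<And>x. x \<in> K \<Longrightarrow> norm (g x - f x) \<le> norm (g a - f a)"
      using continuous_attains_sup[OF K(1) False] by blast
    have "tau_c_nbhd U g K (e - norm (g a - f a)) \<subseteq> tau_c_nbhd U f K e"
    proof
      fix h assume h: "h \<in> tau_c_nbhd U g K (e - norm (g a - f a))"
      have "norm (h x - f x) < e" if "x \<in> K" for x
      proof -
        have "norm (h x - f x) \<le> norm (h x - g x) + norm (g x - f x)"
          using norm_triangle_ineq[of "h x - g x" "g x - f x"] by simp
        then show ?thesis
          using h a(2)[OF that] that by (fastforce simp: tau_c_nbhd_def)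
      qed
      with h show "h \<in> tau_c_nbhd U f K e"
        by (auto simp: tau_c_nbhd_def)
    qed
    then show ?thesis
      using K g'(2)[OF a(1)] by (intro exI[of _ K] exI[of _ "e - norm (g a - f a)"]) auto
  qed
qed

lemma topspace_tau_c: "topspace (tau_c U) = holomorphic_maps U"
proof
  show "topspace (tau_c U) \<subseteq> holomorphic_maps U"
    using openin_topspace[of "tau_c U"] unfolding openin_tau_c tau_c_open_def by blast
  show "holomorphic_maps U \<subseteq> topspace (tau_c U)"
  proof (rule openin_subset)
    show "openin (tau_c U) (holomorphic_maps U)"
      unfolding openin_tau_c tau_c_open_def
      by (auto simp: tau_c_nbhd_def intro!: exI[of _ "{}"] exI[of _ 1])
  qed
qed

text \<open>Turns topological closure into uniform approximation on compact sets, the form used in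
  all later arguments. The inclusion of \<open>A\<close> in the holomorphic maps places an
  approximant in \<open>tau_c_nbhd\<close>.\<close>

lemma in_tau_c_closure:
  assumes "A \<subseteq> holomorphic_maps U"
  shows "f \<in> tau_c U closure_of A \<longleftrightarrow> f \<in> holomorphic_maps U \<and>
    (\<forall>K e. compact K \<longrightarrow> K \<subseteq> U \<longrightarrow> 0 < e \<longrightarrow> (\<exists>g\<in>A. \<forall>x\<in>K. norm (g x - f x) < e))"
proof (intro iffI conjI allI impI)
  assume f: "f \<in> tau_c U closure_of A"
  then show holo: "f \<in> holomorphic_maps U"
    using closure_of_subset_topspace[of "tau_c U" A] unfolding topspace_tau_c by blast
  fix K and e :: real assume K: "compact K" "K \<subseteq> U" "0 < e"
  have "f \<in> tau_c_nbhd U f K e"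
    using holo K by (simp add: tau_c_nbhd_def)
  then obtain g where "g \<in> A" "g \<in> tau_c_nbhd U f K e"
    using f openin_tau_c_nbhd[OF holo K(1,2)] unfolding in_closure_of by blast
  then show "\<exists>g\<in>A. \<forall>x\<in>K. norm (g x - f x) < e"
    by (auto simp: tau_c_nbhd_def)
next
  assume f: "f \<in> holomorphic_maps U \<and>
    (\<forall>K e. compact K \<longrightarrow> K \<subseteq> U \<longrightarrow> 0 < e \<longrightarrow> (\<exists>g\<in>A. \<forall>x\<in>K. norm (g x - f x) < e))"
  show "f \<in> tau_c U closure_of A"
    unfolding in_closure_of topspace_tau_c
  proof (intro conjI allI impI)
    show "f \<in> holomorphic_maps U" using f by blast
    fix T assume "f \<in> T \<and> openin (tau_c U) T"
    then obtain K e where K: "compact K" "K \<subseteq> U" "0 < e" "tau_c_nbhd U f K e \<subseteq> T"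
      unfolding openin_tau_c tau_c_open_def by blast
    then obtain g where "g \<in> A" "\<forall>x\<in>K. norm (g x - f x) < e"
      using f by blast
    then show "\<exists>g. g \<in> A \<and> g \<in> T"
      using K(4) assms by (auto simp: tau_c_nbhd_def)
  qed
qed

section \<open>Pointwise description of the weighted balls\<close>

lemma weighted_tensor_ball_holomorphic: "weighted_tensor_ball U w l \<subseteq> holomorphic_maps U"
  by (auto simp: weighted_tensor_ball_def weighted_tensor_def weighted_space_def)

text \<open>A pointwise bound \<open>l\<close> yields both boundedness and the bound on the
  supremum; nonemptiness keeps the real supremum from being unspecified.\<close>

lemma in_weighted_space_ball:
  assumes "U \<noteq> {}"
  shows "f \<in> weighted_space_ball U w l \<longleftrightarrow>
    f \<in> holomorphic_maps U \<and> (\<forall>x\<in>U. w x * norm (f x) \<le> l)"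
proof -
  have "bdd_above ((\<lambda>x. w x * norm (f x)) ` U) \<and> (SUP x\<in>U. w x * norm (f x)) \<le> l
    \<longleftrightarrow> (\<forall>x\<in>U. w x * norm (f x) \<le> l)" (is "?L \<longleftrightarrow> ?R")
  proof
    assume ?L
    then show ?R by (meson cSUP_upper order_trans)
  next
    assume ?R
    then show ?L using assms by (auto intro: cSUP_least bdd_aboveI2)
  qed
  then show ?thesis
    unfolding weighted_space_ball_def weighted_space_def weighted_norm_def by auto
qed

lemma in_weighted_tensor_ball:
  assumes "U \<noteq> {}"
  shows "f \<in> weighted_tensor_ball U w l \<longleftrightarrow> f \<in> holomorphic_maps U \<and>
    finite_dimensional (f ` U) \<and> (\<forall>x\<in>U. w x * norm (f x) \<le> l)"
  using in_weighted_space_ball[OF assms, of f w l]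
  unfolding weighted_space_ball_def weighted_tensor_ball_def weighted_tensor_def by auto

section \<open>From the approximation property to approximation of the unit ball\<close>

lemma ball_subset_closure_if_bap:
  fixes U :: "'a::complex_banach_space set"
  assumes bap: "lambda_bounded_approximation_property TYPE('b::complex_banach_space) l" "l \<ge> 1"
    and U: "U \<noteq> {}" and w: "\<And>x. x \<in> U \<Longrightarrow> 0 < w x"
  shows "(weighted_space_ball U w 1 :: ('a \<Rightarrow> 'b) set)
    \<subseteq> tau_c U closure_of weighted_tensor_ball U w l"
proof
  fix f :: "'a \<Rightarrow> 'b" assume "f \<in> weighted_space_ball U w 1"
  then have f: "f \<in> holomorphic_maps U" "\<And>x. x \<in> U \<Longrightarrow> w x * norm (f x) \<le> 1"
    by (auto simp: in_weighted_space_ball[OF U])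
  show "f \<in> tau_c U closure_of weighted_tensor_ball U w l"
    unfolding in_tau_c_closure[OF weighted_tensor_ball_holomorphic]
  proof (intro conjI allI impI f(1))
    fix K and e :: real assume K: "compact K" "K \<subseteq> U" "0 < e"
    have "compact (f ` K)"
      using K f(1) by (intro compact_continuous_image holomorphic_maps_continuous_on)
    then obtain T :: "'b \<Rightarrow> 'b" where T: "bounded_complex_linear T" "finite_dimensional (range T)"
      "onorm T \<le> l" "\<And>y. y \<in> f ` K \<Longrightarrow> norm (T y - y) < e"
      using bap(1)[unfolded lambda_bounded_approximation_property_def, rule_format, OF K(3)] by metis
    have "w x * norm (T (f x)) \<le> l" if x: "x \<in> U" for x
    proof -
      have "norm (T (f x)) \<le> onorm T * norm (f x)"
        by (rule onorm[OF bounded_complex_linearD(1)[OF T(1)]])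
      also have "\<dots> \<le> l * norm (f x)"
        using T(3) by (intro mult_right_mono) auto
      finally have "w x * norm (T (f x)) \<le> l * (w x * norm (f x))"
        using w[OF x] by (simp add: mult.left_commute)
      also have "\<dots> \<le> l * 1"
        using f(2)[OF x] bap(2) by (intro mult_left_mono) auto
      finally show ?thesis by simp
    qed
    moreover have "finite_dimensional ((\<lambda>x. T (f x)) ` U)"
      using T(2) by (rule finite_dimensional_subset) auto
    ultimately have "(\<lambda>x. T (f x)) \<in> weighted_tensor_ball U w l"
      using holomorphic_maps_compose[OF T(1) f(1)] by (simp add: in_weighted_tensor_ball[OF U])
    then show "\<exists>g\<in>weighted_tensor_ball U w l. \<forall>x\<in>K. norm (g x - f x) < e"
      by (rule rev_bexI) (simp add: T(4))
  qed
qed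

text \<open>Approximants of \<open>f\<close> within \<open>e / r\<close> are multiplied by
  \<open>r\<close>. This later undoes the normalization that brings the inclusion into the unit
  ball.\<close>

lemma weighted_tensor_closure_scaleR:
  fixes U :: "'a::complex_banach_space set" and f :: "'a \<Rightarrow> 'b::complex_banach_space"
  assumes f: "f \<in> tau_c U closure_of weighted_tensor_ball U w l" and U: "U \<noteq> {}" and r: "r > 0"
  shows "(\<lambda>x. r *\<^sub>R f x) \<in> tau_c U closure_of weighted_tensor_ball U w (r * l)"
  unfolding in_tau_c_closure[OF weighted_tensor_ball_holomorphic]
proof (intro conjI allI impI)
  note f' = f[unfolded in_tau_c_closure[OF weighted_tensor_ball_holomorphic]]
  show "(\<lambda>x. r *\<^sub>R f x) \<in> holomorphic_maps U"
    by (rule holomorphic_maps_scaleR[OF f'[THEN conjunct1]])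
  fix K and e :: real assume K: "compact K" "K \<subseteq> U" "0 < e"
  then have "0 < e / r" using r by simp
  then obtain g where g: "g \<in> weighted_tensor_ball U w l" "\<And>x. x \<in> K \<Longrightarrow> norm (g x - f x) < e / r"
    using f'[THEN conjunct2, rule_format, OF K(1,2)] by metis
  note g' = g(1)[unfolded in_weighted_tensor_ball[OF U]]
  obtain B where B: "finite B" "g ` U \<subseteq> C.span B"
    using g' unfolding finite_dimensional_def by blast
  have "finite_dimensional ((\<lambda>x. r *\<^sub>R g x) ` U)"
    unfolding finite_dimensional_def
    by (intro exI[of _ B]) (use B in \<open>auto simp flip: scaleC_of_real intro!: C.span_scale\<close>)
  moreover have "w x * norm (r *\<^sub>R g x) \<le> r * l" if "x \<in> U" for x
    using g' that r by (simp add: mult.left_commute)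
  ultimately have "(\<lambda>x. r *\<^sub>R g x) \<in> weighted_tensor_ball U w (r * l)"
    using holomorphic_maps_scaleR[OF g'[THEN conjunct1]] by (simp add: in_weighted_tensor_ball[OF U])
  moreover have "norm (r *\<^sub>R g x - r *\<^sub>R f x) < e" if "x \<in> K" for x
  proof -
    have "norm (r *\<^sub>R g x - r *\<^sub>R f x) = r * norm (g x - f x)"
      using r by (simp flip: scaleR_diff_right)
    then show ?thesis
      using g(2)[OF that] r by (simp add: pos_less_divide_eq mult.commute)
  qed
  ultimately show "\<exists>h\<in>weighted_tensor_ball U w (r * l). \<forall>x\<in>K. norm (h x - r *\<^sub>R f x) < e"
    by (intro bexI[of _ "\<lambda>x. r *\<^sub>R g x"]) simp_all
qed

section \<open>The derivative at the origin as an approximating operator\<close>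

text \<open>Complex homogeneity turns \<open>D (h *\<^sub>C x)\<close> into
  \<open>h *\<^sub>C D x\<close>, reducing to functions of one complex variable.\<close>

lemma has_derivative_along_line:
  assumes D: "bounded_complex_linear D" and f: "(f has_derivative D) (at (z *\<^sub>C x))"
  shows "((\<lambda>z. f (z *\<^sub>C x)) has_derivative (\<lambda>h. h *\<^sub>C D x)) (at z)"
proof -
  have "((\<lambda>z. z *\<^sub>C x) has_derivative (\<lambda>h. h *\<^sub>C x)) (at z)"
    using bounded_bilinear.bounded_linear_left[OF bounded_bilinear_scaleC]
    by (rule bounded_linear_imp_has_derivative)
  from has_derivative_compose[OF this f] show ?thesis
    using D by (simp add: bounded_complex_linear_def)
qed

text \<open>The one-variable Cauchy estimate is applied to
  \<open>f (z *\<^sub>C x) - z *\<^sub>C c\<close>, whose derivative at 0 is \<open>D x - c\<close>.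
  Taking \<open>c = 0\<close> bounds the operator; taking \<open>c = x\<close> measures its
  deviation from the identity. The bound 1/2 on \<open>norm x\<close> keeps
  \<open>z *\<^sub>C x\<close> in the unit ball for \<open>cmod z < 2\<close>.\<close>

lemma derivative_zero_estimate:
  fixes f :: "'a::complex_banach_space \<Rightarrow> 'b::complex_banach_space"
  assumes f: "f \<in> holomorphic_maps (ball 0 1)" and fin: "finite_dimensional (f ` ball 0 1)"
    and D: "bounded_complex_linear D" "(f has_derivative D) (at 0)"
    and x: "norm x \<le> 1 / 2"
    and M: "0 \<le> M" "\<And>z. cmod z = 1 \<Longrightarrow> norm (f (z *\<^sub>C x) - z *\<^sub>C c) \<le> M"
  shows "norm (D x - c) \<le> M"
proof -
  obtain D' where D': "\<And>y. y \<in> ball 0 1 \<Longrightarrow> bounded_complex_linear (D' y) \<and> (f has_derivative D' y) (at y)"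
    using f unfolding holomorphic_maps_def by (auto simp: Ball_def) metis
  have in_ball: "z *\<^sub>C x \<in> ball 0 1" if "z \<in> ball 0 2" for z
  proof -
    have "cmod z * norm x \<le> cmod z * (1 / 2)"
      using x by (intro mult_left_mono) auto
    also have "\<dots> < 1" using that by simp
    finally show ?thesis by (simp add: norm_scaleC)
  qed
  obtain B where B: "finite B" "f ` ball 0 1 \<subseteq> C.span B"
    using fin unfolding finite_dimensional_def by blast
  have "norm (D' (0 *\<^sub>C x) x - c) \<le> M"
  proof (rule cauchy_estimate_unit_circle[OF _ _ M])
    \<comment> \<open>Subtracting multiples of \<open>c\<close> may leave the span of
      \<open>B\<close>, so \<open>c\<close> joins the generators.\<close>
    have "f (z *\<^sub>C x) - z *\<^sub>C c \<in> C.span (insert c B)" if "z \<in> ball 0 2" for z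
      using B(2) in_ball[OF that] C.span_mono[OF subset_insertI[of B c]]
      by (intro C.span_diff C.span_scale) (blast, simp add: C.span_base)
    then show "finite_dimensional ((\<lambda>z. f (z *\<^sub>C x) - z *\<^sub>C c) ` ball 0 2)"
      unfolding finite_dimensional_def using B(1) by (intro exI[of _ "insert c B"]) auto
    fix z :: complex assume "z \<in> ball 0 2"
    then have "((\<lambda>z. f (z *\<^sub>C x)) has_derivative (\<lambda>h. h *\<^sub>C D' (z *\<^sub>C x) x)) (at z)"
      using D' in_ball by (intro has_derivative_along_line) auto
    moreover have "((\<lambda>z. z *\<^sub>C c) has_derivative (\<lambda>h. h *\<^sub>C c)) (at z)"
      using bounded_bilinear.bounded_linear_left[OF bounded_bilinear_scaleC]
      by (rule bounded_linear_imp_has_derivative)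
    ultimately show "((\<lambda>z. f (z *\<^sub>C x) - z *\<^sub>C c) has_derivative
        (\<lambda>h. h *\<^sub>C (D' (z *\<^sub>C x) x - c))) (at z)"
      using has_derivative_diff by (fastforce simp: C.scale_right_diff_distrib)
  qed
  moreover have "D' 0 = D"
    using D' D(2) has_derivative_unique by (metis centre_in_ball zero_less_one)
  ultimately show ?thesis by simp
qed

text \<open>The closed ball of radius 1/2 stays in the unit ball under translations shorter than
  1/2, so it is \<open>U_bounded\<close> and the weight has a positive infimum on it.\<close>

lemma weight_lower_bound:
  fixes w :: "'a::complex_banach_space \<Rightarrow> real"
  assumes "weight (ball 0 1) w"
  obtains m where "m > 0" "\<And>x. norm x \<le> 1 / 2 \<Longrightarrow> m \<le> w x"
proof
  let ?A = "cball (0::'a) (1 / 2)"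
  have "a + v \<in> ball 0 1" if "a \<in> ?A" "v \<in> ball 0 (1 / 2)" for a v :: 'a
    using that norm_triangle_ineq[of a v] by simp
  then have "U_bounded (ball 0 1) ?A"
    unfolding U_bounded_def by (auto intro!: exI[of _ "ball 0 (1 / 2)"])
  moreover have "?A \<noteq> {}" by simp
  ultimately show "0 < (INF x\<in>?A. w x)"
    using assms unfolding weight_def by blast
  have "bdd_below (w ` ?A)"
    using assms unfolding weight_def by (intro bdd_belowI2[of _ 0]) (force intro: less_imp_le)
  then show "(INF x\<in>?A. w x) \<le> w x" if "norm x \<le> 1 / 2" for x
    using that by (intro cINF_lower) auto
qed

lemma bap_if_ident_in_closure:
  fixes w :: "'a::complex_banach_space \<Rightarrow> real"
  assumes w: "weight (ball 0 1) w" and l: "l \<ge> 1"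
    and ident: "(\<lambda>x. x) \<in> tau_c (ball 0 1) closure_of weighted_tensor_ball (ball 0 1) w l"
  shows "bounded_approximation_property TYPE('a)"
proof -
  obtain m where m: "m > 0" "\<And>x. norm x \<le> 1 / 2 \<Longrightarrow> m \<le> w x"
    using weight_lower_bound[OF w] by blast
  \<comment> \<open>On the sphere of radius 1/2 an approximant has norm at most
    \<open>l / m\<close>; rescaling to unit vectors doubles this. The constant is independent of
    \<open>K\<close> and \<open>e\<close>. The maximum with 1 meets the range required of the
    constant.\<close>
  have "lambda_bounded_approximation_property TYPE('a) (max 1 (2 * l / m))"
    unfolding lambda_bounded_approximation_property_def
  proof (intro allI impI)
    fix K :: "'a set" and e :: real assume "e > 0" "compact K"
    obtain R where R: "R > 0" "\<And>x. x \<in> K \<Longrightarrow> norm x \<le> R"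
      using compact_imp_bounded[OF \<open>compact K\<close>] bounded_pos by blast
    define s where "s = 1 / (2 * R)"
    have "s > 0" using R by (simp add: s_def)
    have sK: "norm (s *\<^sub>R x) \<le> 1 / 2" if "x \<in> K" for x
      using R(1) R(2)[OF that] by (simp add: s_def field_simps)
    \<comment> \<open>The circles through the points of \<open>s *\<^sub>R x\<close> for
      \<open>x\<close> in \<open>K\<close>: a continuous image of a compact product, inside the unit
      ball, on which Cauchy's estimate needs the approximation.\<close>
    define L where "L = (\<lambda>(z, x). z *\<^sub>C s *\<^sub>R x) ` (sphere 0 1 \<times> K)"
    have "compact L"
      unfolding L_def case_prod_beta using \<open>compact K\<close>
      by (intro compact_continuous_image compact_Times
          bounded_bilinear.continuous_on[OF bounded_bilinear_scaleC] continuous_intros) auto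
    moreover have "L \<subseteq> ball 0 1"
      using sK by (force simp: L_def norm_scaleC)
    \<comment> \<open>The factor \<open>s\<close> is divided out at the end. The half restores
      strictness, since the Cauchy estimate gives only a weak inequality.\<close>
    moreover have "0 < e * s / 2" using \<open>e > 0\<close> \<open>s > 0\<close> by simp
    ultimately obtain f where f: "f \<in> weighted_tensor_ball (ball 0 1) w l"
      and approx: "\<And>x. x \<in> L \<Longrightarrow> norm (f x - x) < e * s / 2"
      using ident[unfolded in_tau_c_closure[OF weighted_tensor_ball_holomorphic], THEN conjunct2]
      by metis
    have f_holo: "f \<in> holomorphic_maps (ball 0 1)"
      and f_fin: "finite_dimensional (f ` ball 0 1)"
      and f_bound: "\<And>x. norm x < 1 \<Longrightarrow> w x * norm (f x) \<le> l"
      using f by (auto simp: in_weighted_tensor_ball)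
    obtain D where D: "bounded_complex_linear D" "(f has_derivative D) (at 0)"
      using f_holo unfolding holomorphic_maps_def by fastforce
    have "finite_dimensional (range D)"
      using f_fin derivative_in_span[OF D(2) _ open_ball, of _ 0 1]
      unfolding finite_dimensional_def by (auto simp: image_subset_iff)
    moreover have "onorm D \<le> max 1 (2 * l / m)"
    proof (rule onorm_bound)
      show "0 \<le> max 1 (2 * l / m)" by simp
      fix x :: 'a
      show "norm (D x) \<le> max 1 (2 * l / m) * norm x"
      proof (cases "x = 0")
        case False
        have lin: "D (r *\<^sub>R y) = r *\<^sub>R D y" for r y
          using bounded_complex_linearD(2)[OF D(1), of "of_real r"] by (simp add: scaleC_of_real)
        define y where "y = (1 / (2 * norm x)) *\<^sub>R x"
        have y: "norm y = 1 / 2" using False by (simp add: y_def)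
        \<comment> \<open>The case \<open>c = 0\<close> of the estimate, with the weight bounded
          below by \<open>m\<close> on the circle.\<close>
        have "norm (D y - 0) \<le> l / m"
        proof (rule derivative_zero_estimate[OF f_holo f_fin D])
          fix z :: complex assume "cmod z = 1"
          then have z: "norm (z *\<^sub>C y) = 1 / 2" using y by (simp add: norm_scaleC)
          have "m * norm (f (z *\<^sub>C y)) \<le> w (z *\<^sub>C y) * norm (f (z *\<^sub>C y))"
            using m(2) z by (intro mult_right_mono) auto
          also have "\<dots> \<le> l" using f_bound z by simp
          finally show "norm (f (z *\<^sub>C y) - z *\<^sub>C 0) \<le> l / m"
            using m(1) by (simp add: field_simps)
        qed (use y m l in auto)
        then have "norm (D x) \<le> 2 * l / m * norm x"
          using False by (simp add: y_def lin field_simps)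
        also have "\<dots> \<le> max 1 (2 * l / m) * norm x"
          by (intro mult_right_mono) auto
        finally show ?thesis .
      qed (use bounded_linear.linear[OF bounded_complex_linearD(1)[OF D(1)]]
          in \<open>simp add: linear_0\<close>)
    qed
    moreover have "norm (D x - x) < e" if x: "x \<in> K" for x
    proof -
      \<comment> \<open>The case \<open>c = s *\<^sub>R x\<close>, where the circle through that
        point lies in \<open>L\<close>.\<close>
      have "norm (D (s *\<^sub>R x) - s *\<^sub>R x) \<le> e * s / 2"
      proof (rule derivative_zero_estimate[OF f_holo f_fin D sK[OF x]])
        fix z :: complex assume "cmod z = 1"
        then have "z *\<^sub>C s *\<^sub>R x \<in> L" using x by (auto simp: L_def)
        then show "norm (f (z *\<^sub>C s *\<^sub>R x) - z *\<^sub>C s *\<^sub>R x) \<le> e * s / 2"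
          using approx by (simp add: less_imp_le)
      qed (use \<open>e > 0\<close> \<open>s > 0\<close> in simp)
      moreover have "D (s *\<^sub>R x) - s *\<^sub>R x = s *\<^sub>R (D x - x)"
        using bounded_complex_linearD(2)[OF D(1), of "of_real s"]
        by (simp add: scaleC_of_real scaleR_diff_right)
      ultimately have "s * norm (D x - x) \<le> s * (e / 2)"
        using \<open>s > 0\<close> by (simp add: mult.commute)
      then have "norm (D x - x) \<le> e / 2"
        using \<open>s > 0\<close> by (simp only: mult_le_cancel_left_pos)
      then show ?thesis using \<open>e > 0\<close> by simp
    qed
    ultimately show "\<exists>T. bounded_complex_linear T \<and> finite_dimensional (range T) \<and>
        onorm T \<le> max 1 (2 * l / m) \<and> (\<forall>x\<in>K. norm (T x - x) < e)"
      using D(1) by blast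
  qed
  then show ?thesis
    unfolding bounded_approximation_property_def by (metis max.cobounded1)
qed

section \<open>From the unit ball to the inclusion, and the equivalence\<close>

text \<open>With \<open>w\<close> at most \<open>M\<close> on the unit ball, \<open>x / M\<close>
  has weighted norm at most 1. Approximating it and scaling back costs a factor \<open>M\<close> in
  the radius.\<close>

lemma ident_in_closure_if_ball_subset:
  fixes w :: "'a::complex_banach_space \<Rightarrow> real"
  assumes w: "bounded_weight (ball 0 1) w" and l: "l \<ge> 1"
    and sub: "(weighted_space_ball (ball 0 1) w 1 :: ('a \<Rightarrow> 'a) set)
      \<subseteq> tau_c (ball 0 1) closure_of weighted_tensor_ball (ball 0 1) w l"
  shows "\<exists>l'\<ge>1. (\<lambda>x::'a. x) \<in> tau_c (ball 0 1) closure_of weighted_tensor_ball (ball 0 1) w l'"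
proof -
  obtain M0 where M0: "\<And>x. x \<in> ball 0 1 \<Longrightarrow> w x \<le> M0"
    using w unfolding bounded_weight_def bdd_above_def by fast
  have w0: "0 < w x" if "x \<in> ball 0 1" for x
    using w that unfolding bounded_weight_def weight_def by blast
  \<comment> \<open>The maximum with 1 makes division by \<open>M\<close> safe and gives
    \<open>M * l \<ge> 1\<close>.\<close>
  define M where "M = max 1 M0"
  have M: "M \<ge> 1" "\<And>x. x \<in> ball 0 1 \<Longrightarrow> w x \<le> M"
    using M0 by (auto simp: M_def le_max_iff_disj)
  have "w x * norm ((1 / M) *\<^sub>R x) \<le> 1" if x: "x \<in> ball 0 1" for x
  proof -
    have "w x * norm x \<le> M * 1"
      using M x w0[OF x] by (intro mult_mono) auto
    then show ?thesis using M(1) by (simp add: field_simps)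
  qed
  then have "(\<lambda>x. (1 / M) *\<^sub>R x) \<in> weighted_space_ball (ball 0 1) w 1"
    using holomorphic_maps_scaleR[OF ident_holomorphic]
    by (simp add: in_weighted_space_ball)
  then have "(\<lambda>x. M *\<^sub>R (1 / M) *\<^sub>R x)
      \<in> tau_c (ball 0 1) closure_of weighted_tensor_ball (ball 0 1) w (M * l)"
    using sub M(1) by (intro weighted_tensor_closure_scaleR) auto
  moreover have "M * l \<ge> 1"
    using mult_mono[of 1 M 1 l] M(1) l by simp
  ultimately show ?thesis
    using M(1) by (intro exI[of _ "M * l"]) simp
qed

text \<open>Assertion (b) is expressed as an inclusion: for \<open>l > 1\<close> and a nonzero
  space, the tensor ball of radius \<open>l\<close> contains constant maps of weighted norm
  \<open>l\<close>, so its closure exceeds the unit ball. The implications form the cycle (a), (b),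
  (c), (a).\<close>

theorem theorem3p7:
  fixes U :: "'a::complex_banach_space set" and w :: "'a \<Rightarrow> real"
  defines "U \<equiv> ball 0 1"
  assumes "bounded_weight U w"
  shows "(bounded_approximation_property TYPE('a) \<longleftrightarrow>
           (\<exists>l\<ge>1. (weighted_space_ball U w 1 :: ('a \<Rightarrow> 'a) set)
                     \<subseteq> tau_c U closure_of weighted_tensor_ball U w l))
       \<and> (bounded_approximation_property TYPE('a) \<longleftrightarrow>
           (\<exists>l'\<ge>1. (\<lambda>x::'a. x) \<in> tau_c U closure_of weighted_tensor_ball U w l'))"
    (is "(?a \<longleftrightarrow> ?b) \<and> (?a \<longleftrightarrow> ?c)")
proof -
  have w: "bounded_weight (ball 0 1) w"
    using assms by simp
  then have "weight (ball 0 1) w"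
    by (simp add: bounded_weight_def)
  then have "?a \<Longrightarrow> ?b"
    using ball_subset_closure_if_bap[of _ "ball 0 1" w]
    unfolding bounded_approximation_property_def U_def weight_def by fastforce
  moreover have "?b \<Longrightarrow> ?c"
    using ident_in_closure_if_ball_subset[OF w] unfolding U_def by blast
  moreover have "?c \<Longrightarrow> ?a"
    using bap_if_ident_in_closure[OF \<open>weight (ball 0 1) w\<close>] unfolding U_def by blast
  ultimately show ?thesis by blast
qed

end
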